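(* (Right Pieri rule.) Let $A$ be a finite alphabet of colors, let $J=(v_1,\dots,v_h)$ be a sentence and $w$ a word over $A$. Then $$\mathfrak{S}_J\,H_w=\sum_{K}\mathfrak{S}_K,$$ where the sum runs over all sentences $K=(u_1,\dots,u_g)$ with $h\le g\le h+1$ for which there exist (possibly empty) words $q_1,\dots,q_g$ with $u_j=v_j\cdot q_j$ for $1\le j\le g$ (where $v_{h+1}=\emptyset$) and $q_g\cdot q_{g-1}\cdots q_1=w$.
   Context: Words are finite sequences of colors, $\cdot$ denotes concatenation; a sentence is a finite sequence $I=(w_1,\dots,w_k)$ of nonempty words (the empty sentence is $\emptyset$); $\ell(I)=k$; for sentences with the same concatenated word $w_1\cdots w_k$, $Q\preceq S$ means $S$ is obtained from $Q$ by concatenating some adjacent words. Let $x_{a,i}$ ($a\in A$, $i\ge1$) be variables subject only to $x_{a,i}x_{b,j}=x_{b,j}x_{a,i}$ for $i\ne j$; $x_{w,i}=x_{c_1,i}\cdots x_{c_r,i}$ for $w=c_1\cdots c_r$. $M_I=\sum_{j_1<\dots<j_k}x_{w_1,j_1}\cdots x_{w_k,j_k}$, $M_\emptyset=1$; $QSym_A$ is the span of the $M_I$, an algebra under multiplication of power series. $NSym_A$ is the free associative $\mathbb{Q}$-algebra on generators $H_w$, $w$ a nonempty word; $H_I=H_{w_1}\cdots H_{w_k}$, $H_\emptyset=1$; the pairing $\langle\cdot,\cdot\rangle:NSym_A\times QSym_A\to\mathbb{Q}$ is $\langle H_I,M_J\rangle=\delta_{I,J}$. For $M\in QSym_A$,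 the right perp operator $M^{\perp_r}$ on $NSym_A$ is the linear map with $\langle M^{\perp_r}(H),G\rangle=\langle H,GM\rangle$ for all $G\in QSym_A$. For a nonempty word $v$, the colored noncommutative Bernstein operator is $$\mathbb{B}_v(f)=\sum_u\sum_{Q}(-1)^{\ell(Q)}H_{(v\cdot u)}\Big(\sum_{S\succeq Q}M^{\perp_r}_S(f)\Big),$$ where $u$ runs over all words (including the empty word, for which only $Q=\emptyset$ occurs and $M^{\perp_r}_\emptyset$ is the identity), $Q=(q_1,\dots,q_i)$ runs over sentences with $q_i\cdot q_{i-1}\cdots q_1=u$, $S$ over coarsenings of $Q$, and $H_{(v\cdot u)}$ is the generator indexed by the one-word sentence $(v\cdot u)$, multiplied on the left. For a sentence $J=(v_1,\dots,v_h)$ the colored immaculate function is $\mathfrak{S}_J=\mathbb{B}_{v_1}\mathbb{B}_{v_2}\cdots\mathbb{B}_{v_h}(1)$. *)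

theory Defs
  imports Complex_Main "HOL-Library.Poly_Mapping"
begin

section \<open>Words and sentences\<close>

text \<open>The alphabet of colors is a type \<open>'a\<close>; words are lists over \<open>'a\<close>.\<close>

typedef 'a sentence = "{I :: 'a list list. [] \<notin> set I}"
  morphisms words Sentence
  by (rule exI[of _ "[]"]) simp

setup_lifting type_definition_sentence

instantiation sentence :: (type) monoid_add
begin

lift_definition zero_sentence :: "'a sentence" is "[]" by simp

lift_definition plus_sentence :: "'a sentence \<Rightarrow> 'a sentence \<Rightarrow> 'a sentence" is "(@)" by auto

instance by standard (transfer; simp)+

end

definition slen :: "'a sentence \<Rightarrow> nat" where
  "slen I = length (words I)"

text \<open>\<open>S\<close> is a coarsening of \<open>Q\<close>: cut \<open>Q\<close> into nonempty blocks of adjacent words and concatenate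
  each block.\<close>

definition coarsens :: "'a sentence \<Rightarrow> 'a sentence \<Rightarrow> bool" (infix "\<preceq>" 50) where
  "Q \<preceq> S \<longleftrightarrow> (\<exists>B. [] \<notin> set B \<and> concat B = words Q \<and> map concat B = words S)"


section \<open>Power series in partially commuting variables\<close>

text \<open>A variable \<open>x\<^bsub>a,i\<^esub>\<close> is the pair \<open>(a, i)\<close>. Monomials are words in the variables modulo the
  congruence generated by \<open>x\<^bsub>a,i\<^esub> x\<^bsub>b,j\<^esub> = x\<^bsub>b,j\<^esub> x\<^bsub>a,i\<^esub>\<close> for \<open>i \<noteq> j\<close>. The variables with index \<open>0\<close>
  are present in the ambient ring but never used.\<close>

inductive swap :: "('a \<times> nat) list \<Rightarrow> ('a \<times> nat) list \<Rightarrow> bool" where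
  "i \<noteq> j \<Longrightarrow> swap (p @ [(a, i), (b, j)] @ q) (p @ [(b, j), (a, i)] @ q)"

lemma swap_append_left: "swap x y \<Longrightarrow> swap (z @ x) (z @ y)"
proof (induction rule: swap.induct)
  case (1 i j p a b q)
  then show ?case using swap.intros[of i j "z @ p" a b q] by simp
qed

lemma swap_append_right: "swap x y \<Longrightarrow> swap (x @ z) (y @ z)"
proof (induction rule: swap.induct)
  case (1 i j p a b q)
  then show ?case using swap.intros[of i j p a b "q @ z"] by simp
qed

lemma equivclp_swap_append:
  assumes "equivclp swap x x'" "equivclp swap y y'"
  shows "equivclp swap (x @ y) (x' @ y')"
proof -
  have "equivclp swap (x @ y) (x' @ y)"
    using assms(1)
  proof (induction rule: equivclp_induct)
    case (step u v)
    then show ?case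
      by (blast intro: equivclp_trans r_into_equivclp converse_r_into_equivclp swap_append_right)
  qed simp
  moreover have "equivclp swap (x' @ y) (x' @ y')"
    using assms(2)
  proof (induction rule: equivclp_induct)
    case (step u v)
    then show ?case
      by (blast intro: equivclp_trans r_into_equivclp converse_r_into_equivclp swap_append_left)
  qed simp
  ultimately show ?thesis by (rule equivclp_trans)
qed

lemma swap_set_length: "swap x y \<Longrightarrow> set x = set y \<and> length x = length y"
  by (induction rule: swap.induct) auto

lemma equivclp_swap_set_length:
  assumes "equivclp swap x y"
  shows "set x = set y \<and> length x = length y"
  using assms
proof (induction rule: equivclp_induct)
  case (step u v)
  then show ?case using swap_set_length[of u v] swap_set_length[of v u] by metis
qed simp

quotient_type 'a monomial = "('a \<times> nat) list" / "equivclp swap"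
  by (rule equivp_evquivclp)

instantiation monomial :: (type) monoid_mult
begin

lift_definition one_monomial :: "'a monomial" is "[]" .

lift_definition times_monomial :: "'a monomial \<Rightarrow> 'a monomial \<Rightarrow> 'a monomial" is "(@)"
  by (rule equivclp_swap_append)

instance by standard (transfer; simp)+

end

lift_definition var :: "'a \<Rightarrow> nat \<Rightarrow> 'a monomial" is "\<lambda>a i. [(a, i)]" .

definition var_word :: "'a list \<Rightarrow> nat \<Rightarrow> 'a monomial" where
  "var_word w i = prod_list (map (\<lambda>c. var c i) w)"

lemma finite_factorizations: "finite {(p, q). p * q = (m :: 'a monomial)}"
proof -
  define r where "r = rep_monomial m"
  define L where "L = {xs. set xs \<subseteq> set r \<and> length xs \<le> length r}"
  have "{(p, q). p * q = m} \<subseteq> (\<lambda>(x, y). (abs_monomial x, abs_monomial y)) ` (L \<times> L)"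
  proof clarify
    fix p q :: "'a monomial" assume "m = p * q"
    then have "abs_monomial (rep_monomial p @ rep_monomial q) = abs_monomial r"
      by (metis Quotient3_abs_rep Quotient3_monomial r_def times_monomial.abs_eq)
    then have "equivclp swap (rep_monomial p @ rep_monomial q) r"
      by (simp add: monomial.abs_eq_iff)
    from equivclp_swap_set_length[OF this]
    have "rep_monomial p \<in> L" "rep_monomial q \<in> L" by (auto simp: L_def)
    then have "(\<lambda>(x, y). (abs_monomial x, abs_monomial y)) (rep_monomial p, rep_monomial q)
      \<in> (\<lambda>(x, y). (abs_monomial x, abs_monomial y)) ` (L \<times> L)" by blast
    then show "(p, q) \<in> (\<lambda>(x, y). (abs_monomial x, abs_monomial y)) ` (L \<times> L)"
      by (simp add: Quotient3_abs_rep[OF Quotient3_monomial])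
  qed
  moreover have "finite L" unfolding L_def by (rule finite_lists_length_le) simp
  ultimately show ?thesis by (meson finite_SigmaI finite_imageI finite_subset)
qed

typedef 'a pseries = "UNIV :: ('a monomial \<Rightarrow> rat) set"
  morphisms pcoeff Pseries ..

setup_lifting type_definition_pseries

lemma pseries_eqI: "(\<And>m. pcoeff f m = pcoeff g m) \<Longrightarrow> f = g"
  by transfer auto

instantiation pseries :: (type) ring_1
begin

lift_definition zero_pseries :: "'a pseries" is "\<lambda>m. 0" .
lift_definition one_pseries :: "'a pseries" is "\<lambda>m. if m = 1 then 1 else 0" .
lift_definition plus_pseries :: "'a pseries \<Rightarrow> 'a pseries \<Rightarrow> 'a pseries" is "\<lambda>f g m. f m + g m" .
lift_definition minus_pseries :: "'a pseries \<Rightarrow> 'a pseries \<Rightarrow> 'a pseries" is "\<lambda>f g m. f m - g m" .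
lift_definition uminus_pseries :: "'a pseries \<Rightarrow> 'a pseries" is "\<lambda>f m. - f m" .
lift_definition times_pseries :: "'a pseries \<Rightarrow> 'a pseries \<Rightarrow> 'a pseries" is
  "\<lambda>f g m. \<Sum>(p, q) | p * q = m. f p * g q" .

instance
proof
  fix f g h :: "'a pseries"
  show "f * g * h = f * (g * h)"
  proof (transfer, rule ext)
    fix f g h :: "'a monomial \<Rightarrow> rat" and m :: "'a monomial"
    note fin = finite_factorizations
    have "(\<Sum>(p, c) | p * c = m. (\<Sum>(a, b) | a * b = p. f a * g b) * h c)
      = (\<Sum>x\<in>{(p, c). p * c = m}. \<Sum>y\<in>{(a, b). a * b = fst x}. f (fst y) * g (snd y) * h (snd x))"
      by (simp add: case_prod_unfold sum_distrib_right)
    also have "\<dots> = (\<Sum>(x, y)\<in>Sigma {(p, c). p * c = m} (\<lambda>x. {(a, b). a * b = fst x}).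
        f (fst y) * g (snd y) * h (snd x))"
      by (rule sum.Sigma) (use fin in auto)
    also have "\<dots> = (\<Sum>(x, y)\<in>Sigma {(a, q). a * q = m} (\<lambda>x. {(b, c). b * c = snd x}).
        f (fst x) * g (fst y) * h (snd y))"
      by (rule sum.reindex_bij_witness[of _
            "\<lambda>(x, y). ((fst x * fst y, snd y), (fst x, fst y))"
            "\<lambda>(x, y). ((fst y, snd y * snd x), (snd y, snd x))"])
         (auto simp: mult.assoc)
    also have "\<dots> = (\<Sum>x\<in>{(a, q). a * q = m}. \<Sum>y\<in>{(b, c). b * c = snd x}. f (fst x) * g (fst y) * h (snd y))"
      by (rule sum.Sigma[symmetric]) (use fin in auto)
    also have "\<dots> = (\<Sum>(a, q) | a * q = m. f a * (\<Sum>(b, c) | b * c = q. g b * h c))"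
      by (simp add: case_prod_unfold sum_distrib_left mult.assoc)
    finally show "(\<Sum>(p, c) | p * c = m. (\<Sum>(a, b) | a * b = p. f a * g b) * h c)
      = (\<Sum>(a, q) | a * q = m. f a * (\<Sum>(b, c) | b * c = q. g b * h c))" .
  qed
  show "(f + g) * h = f * h + g * h"
    by transfer (simp add: case_prod_unfold algebra_simps sum.distrib)
  show "f * (g + h) = f * g + f * h"
    by transfer (simp add: case_prod_unfold algebra_simps sum.distrib)
  show "1 * f = f"
  proof (transfer, rule ext)
    fix f :: "'a monomial \<Rightarrow> rat" and m
    have "(\<Sum>(p, q) | p * q = m. (if p = 1 then 1 else 0) * f q)
      = (\<Sum>(p, q)\<in>{(1 :: 'a monomial, m)}. (if p = 1 then 1 else 0) * f q)"
      by (rule sum.mono_neutral_right) (auto simp: finite_factorizations split: if_splits)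
    then show "(\<Sum>(p, q) | p * q = m. (if p = 1 then 1 else 0) * f q) = f m" by simp
  qed
  show "f * 1 = f"
  proof (transfer, rule ext)
    fix f :: "'a monomial \<Rightarrow> rat" and m
    have "(\<Sum>(p, q) | p * q = m. f p * (if q = 1 then 1 else 0))
      = (\<Sum>(p, q)\<in>{(m, 1 :: 'a monomial)}. f p * (if q = 1 then 1 else 0))"
      by (rule sum.mono_neutral_right) (auto simp: finite_factorizations split: if_splits)
    then show "(\<Sum>(p, q) | p * q = m. f p * (if q = 1 then 1 else 0)) = f m" by simp
  qed
  show "(0 :: 'a pseries) \<noteq> 1"
    by transfer (auto dest: fun_cong[of _ _ 1])
qed (transfer; simp add: fun_eq_iff)+

end

lift_definition pscale :: "rat \<Rightarrow> 'a pseries \<Rightarrow> 'a pseries" is "\<lambda>c f m. c * f m" .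

interpretation pseries: vector_space pscale
  by standard (transfer; simp add: fun_eq_iff algebra_simps)+


section \<open>Colored quasisymmetric functions\<close>

text \<open>The coefficient of a monomial \<open>m\<close> in the infinite sum defining \<open>M\<^sub>I\<close> is the number of index
  sequences \<open>1 \<le> j\<^sub>1 < \<dots> < j\<^sub>k\<close> whose summand is \<open>m\<close>; there is at most one, since the words of
  \<open>I\<close> are nonempty.\<close>

definition qM :: "'a sentence \<Rightarrow> 'a pseries" where
  "qM I = Pseries (\<lambda>m. of_nat (card {js. length js = slen I \<and> sorted_wrt (<) js \<and>
     (\<forall>j\<in>set js. 1 \<le> j) \<and> prod_list (map2 var_word (words I) js) = m}))"

definition QSym :: "'a pseries set" where
  "QSym = pseries.span (range qM)"


section \<open>Colored noncommutative symmetric functions\<close>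

text \<open>The free algebra on the \<open>H\<^sub>w\<close>, as the monoid algebra of the free monoid of sentences:
  addition of keys is concatenation of sentences, and the basis element of the key \<open>I\<close> is \<open>H\<^sub>I\<close>.\<close>

type_synonym 'a nsym = "'a sentence \<Rightarrow>\<^sub>0 rat"

definition nscale :: "rat \<Rightarrow> 'a nsym \<Rightarrow> 'a nsym" where
  "nscale c f = Poly_Mapping.map ((*) c) f"

definition H_sentence :: "'a sentence \<Rightarrow> 'a nsym" where
  "H_sentence I = Poly_Mapping.single I 1"

definition H_word :: "'a list \<Rightarrow> 'a nsym" where
  "H_word w = (if w = [] then 1 else H_sentence (Sentence [w]))"

text \<open>The bilinear pairing with \<open>\<langle>H\<^sub>I, M\<^sub>J\<rangle> = \<delta>\<^bsub>I,J\<^esub>\<close>: \<open>representation\<close> gives the coordinate of an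
  element of \<open>QSym\<close> at the basis vector \<open>M\<^sub>I\<close>.\<close>

definition pairing :: "'a nsym \<Rightarrow> 'a pseries \<Rightarrow> rat" where
  "pairing F G = (\<Sum>I\<in>Poly_Mapping.keys F.
     Poly_Mapping.lookup F I * pseries.representation (range qM) G (qM I))"

definition perp_r :: "'a pseries \<Rightarrow> 'a nsym \<Rightarrow> 'a nsym" where
  "perp_r M = (THE T. Vector_Spaces.linear nscale nscale T \<and>
     (\<forall>F. \<forall>G\<in>QSym. pairing (T F) G = pairing F (G * M)))"


section \<open>Bernstein operators and colored immaculate functions\<close>

text \<open>\<open>Sum_any\<close> is the sum over all words \<open>u\<close> of finitely supported summands: the summand vanishes
  once \<open>u\<close> is longer than every sentence occurring in \<open>f\<close>.\<close>

definition bernstein :: "'a list \<Rightarrow> 'a nsym \<Rightarrow> 'a nsym" where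
  "bernstein v f = Sum_any (\<lambda>u. \<Sum>Q | concat (rev (words Q)) = u.
     (-1) ^ slen Q * H_word (v @ u) * (\<Sum>S | Q \<preceq> S. perp_r (qM S) f))"

definition immaculate :: "'a sentence \<Rightarrow> 'a nsym" where
  "immaculate J = foldr bernstein (words J) 1"

end

theory Submission
  imports Defs
begin

text \<open>
  Sorting a monomial by its indices turns it into a family of words, which makes multiplication in
  \<open>QSym\<close> a sum over quasi-shuffles in which letters of the left factor come first. Dually,
  \<open>M\<^sub>S\<^sup>\<bottom>\<close> cuts every word \<open>w\<close> of \<open>H\<^sub>I\<close> as \<open>w = p s\<close>, keeps the nonempty \<open>p\<close> and requires the
  nonempty \<open>s\<close> to form \<open>S\<close>. Hence \<open>B\<^sub>v(f) = \<Sum>\<^sub>S G\<^sub>v(S) M\<^sub>S\<^sup>\<bottom>(f)\<close>, where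
  \<open>G\<^sub>v(S) = \<Sum>\<^bsub>Q \<preceq> S\<^esub> (-1)\<^bsup>l(Q)\<^esup> H\<^bsub>v q\<^sub>i \<dots> q\<^sub>1\<^esub>\<close> is called \<open>bcoef\<close> below.

  The Pieri rule follows by induction on \<open>J\<close> from
  \<open>B\<^sub>v(f) H\<^sub>w = \<Sum>\<^bsub>u x = w\<^esub> B\<^bsub>v x\<^esub>(f H\<^sub>u)\<close>. On the right, the words \<open>u\<close> are cut as \<open>u = p s\<close>, where
  \<open>s\<close> is further refined to a sentence \<open>Q\<close> contributing \<open>(-1)\<^bsup>l(Q)\<^esup>\<close> and the word
  \<open>x q\<^sub>i \<dots> q\<^sub>1\<close>; for \<open>x \<noteq> []\<close> the terms of \<open>(Q, x)\<close> and \<open>((q\<^sub>1, \<dots>, q\<^sub>i, x), [])\<close> cancel,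
  leaving only \<open>s = x = []\<close>.
\<close>

section \<open>Monomials as finitely supported families of words\<close>

text \<open>The relations only exchange variables of distinct indices, so the word of colors at each
  index is an invariant of a monomial; \<open>proj_eqI\<close> shows that these words determine
  it.\<close>

lift_definition proj :: "'a monomial \<Rightarrow> nat \<Rightarrow> 'a list"
  is "\<lambda>xs i. map fst (filter (\<lambda>x. snd x = i) xs)"
proof -
  fix xs ys :: "('a \<times> nat) list"
  have sw: "map fst (filter (\<lambda>x. snd x = i) u) = map fst (filter (\<lambda>x. snd x = i) v)"
    if "swap u v" for i :: nat and u v :: "('a \<times> nat) list"
    using that by cases auto
  assume "equivclp swap xs ys"
  then show "(\<lambda>i. map fst (filter (\<lambda>x. snd x = i) xs)) = (\<lambda>i. map fst (filter (\<lambda>x. snd x = i) ys))"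
  proof (induction rule: equivclp_induct)
    case (step u v)
    then show ?case using sw[of u v] sw[of v u] by (auto simp: fun_eq_iff)
  qed simp
qed

lemma equivclp_swap_Cons:
  "equivclp swap x y \<Longrightarrow> equivclp swap (c # x) (c # y)"
  using equivclp_swap_append[of "[c]" "[c]" x y] by simp

lemma equivclp_swap_move_front:
  assumes "\<forall>x\<in>set us. snd x \<noteq> i"
  shows "equivclp swap ((a, i) # us @ vs) (us @ (a, i) # vs)"
  using assms
proof (induction us)
  case (Cons u us)
  obtain b j where u: "u = (b, j)" by (cases u)
  have "swap ((a, i) # u # us @ vs) (u # (a, i) # us @ vs)"
    using swap.intros[of i j "[]" a b "us @ vs"] Cons.prems u by simp
  moreover have "equivclp swap (u # (a, i) # us @ vs) (u # us @ (a, i) # vs)"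
    using Cons by (simp add: equivclp_swap_Cons)
  ultimately show ?case
    by (metis append_Cons equivclp_trans r_into_equivclp)
qed simp

text \<open>Induction on \<open>xs\<close>: its head \<open>(a, i)\<close> matches the first letter
  of index \<open>i\<close> in \<open>ys\<close>. The letters before that one have other indices, so
  it can be commuted to the front, and the remainders still agree index by index.\<close>

lemma equivclp_swap_if_filter_eq:
  assumes "\<And>i. map fst (filter (\<lambda>x. snd x = i) xs) = map fst (filter (\<lambda>x. snd x = i) ys)"
  shows "equivclp swap xs ys"
  using assms
proof (induction xs arbitrary: ys)
  case Nil
  have "ys = []"
  proof (cases ys)
    case (Cons y zs)
    then show ?thesis using Nil[of "snd y"] by simp
  qed
  then show ?case by simp
next
  case (Cons x xs)
  obtain a i where x: "x = (a, i)" by (cases x)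
  obtain z zs where z: "filter (\<lambda>x. snd x = i) ys = z # zs" "a = fst z"
      "map fst (filter (\<lambda>x. snd x = i) xs) = map fst zs"
    using Cons.prems[of i] x by (auto simp: Cons_eq_map_conv)
  obtain us vs where ys: "ys = us @ z # vs" and us: "\<forall>u\<in>set us. snd u \<noteq> i" and "snd z = i"
      and "zs = filter (\<lambda>x. snd x = i) vs"
    using z(1) by (auto simp: filter_eq_Cons_iff)
  then have "z = (a, i)" using z by (cases z) simp
  have "map fst (filter (\<lambda>x. snd x = j) xs) = map fst (filter (\<lambda>x. snd x = j) (us @ vs))" for j
  proof (cases "j = i")
    case True
    have "filter (\<lambda>x. snd x = i) us = []" using us by (auto simp: filter_empty_conv)
    then show ?thesis using True z \<open>zs = _\<close> by simp
  next
    case False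
    then show ?thesis using Cons.prems[of j] x ys \<open>z = _\<close> by simp
  qed
  from Cons.IH[OF this] have "equivclp swap (x # xs) ((a, i) # us @ vs)"
    by (simp add: equivclp_swap_Cons x)
  also have "equivclp swap \<dots> ys"
    using equivclp_swap_move_front[OF us] ys \<open>z = _\<close> by simp
  finally (equivclp_trans) show ?case .
qed

lemma proj_eqI: "proj p = proj q \<Longrightarrow> p = q"
  by transfer (auto intro!: equivclp_swap_if_filter_eq dest: fun_cong)

lemma proj_one [simp]: "proj 1 i = []"
  by transfer simp

lemma proj_times [simp]: "proj (p * q) i = proj p i @ proj q i"
  by transfer simp

lemma proj_var [simp]: "proj (var a j) i = (if i = j then [a] else [])"
  by transfer simp

lemma proj_var_word [simp]: "proj (var_word w j) i = (if i = j then w else [])"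
  unfolding var_word_def by (induction w) auto

section \<open>Supports, and monomials with prescribed words at prescribed indices\<close>

definition supp :: "'a monomial \<Rightarrow> nat set" where
  "supp m = {i. proj m i \<noteq> []}"

lemma proj_eq_Nil_if_notin: "supp m \<subseteq> A \<Longrightarrow> i \<notin> A \<Longrightarrow> proj m i = []"
  by (auto simp: supp_def)

lemma finite_supp [simp]: "finite (supp m)"
  unfolding supp_def
proof transfer
  fix xs :: "('a \<times> nat) list"
  have "{i. map fst (filter (\<lambda>x. snd x = i) xs) \<noteq> []} \<subseteq> snd ` set xs"
    by (auto simp: filter_empty_conv)
  then show "finite {i. map fst (filter (\<lambda>x. snd x = i) xs) \<noteq> []}"
    by (rule finite_subset) simp
qed

lemma supp_times: "supp (p * q) = supp p \<union> supp q"
  by (auto simp: supp_def)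

text \<open>With \<open>ws = words I\<close> this is the summand of \<open>qM I\<close> for the
  index sequence \<open>js\<close>.\<close>

definition mono_of :: "'a list list \<Rightarrow> nat list \<Rightarrow> 'a monomial" where
  "mono_of ws js = prod_list (map2 var_word ws js)"

lemma proj_mono_of_notin: "i \<notin> set js \<Longrightarrow> proj (mono_of ws js) i = []"
  unfolding mono_of_def
  by (induction ws js rule: list_induct2') auto

lemma map_proj_mono_of:
  "length ws = length js \<Longrightarrow> distinct js \<Longrightarrow> map (proj (mono_of ws js)) js = ws"
proof (induction ws js rule: list_induct2)
  case (Cons w ws j js)
  have "mono_of (w # ws) (j # js) = var_word w j * mono_of ws js"
    by (simp add: mono_of_def)
  moreover have "map (\<lambda>i. (if i = j then w else []) @ proj (mono_of ws js) i) js = map (proj (mono_of ws js)) js"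
    using Cons.prems by (intro map_cong) auto
  moreover have "map (proj (mono_of ws js)) js = ws" "proj (mono_of ws js) j = []"
    using Cons by (simp_all add: proj_mono_of_notin)
  ultimately show ?case by simp
qed simp

lemma supp_mono_of_subset: "supp (mono_of ws js) \<subseteq> set js"
  using proj_mono_of_notin by (fastforce simp: supp_def)

lemma mono_of_eq_iff:
  assumes "length ws = length js" "distinct js"
  shows "mono_of ws js = m \<longleftrightarrow> supp m \<subseteq> set js \<and> map (proj m) js = ws"
proof
  assume "supp m \<subseteq> set js \<and> map (proj m) js = ws"
  then have "proj (mono_of ws js) i = proj m i" for i
    using map_proj_mono_of[OF assms] proj_mono_of_notin[of i js ws]
    by (cases "i \<in> set js") (auto simp: proj_eq_Nil_if_notin[of m])
  then show "mono_of ws js = m" by (intro proj_eqI ext)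
qed (use map_proj_mono_of[OF assms] supp_mono_of_subset in auto)

section \<open>Structure constants of the monomial basis\<close>

text \<open>Cutting words may yield empty pieces. Dropping them keeps the result a sentence and
  agrees with \<open>H_word [] = 1\<close>.\<close>

definition squash :: "'a list list \<Rightarrow> 'a sentence" where
  "squash ws = Sentence (filter (\<lambda>w. w \<noteq> []) ws)"

lemma words_squash [simp]: "words (squash ws) = filter (\<lambda>w. w \<noteq> []) ws"
  by (simp add: squash_def Sentence_inverse)

lemma Nil_notin_words [simp]: "[] \<notin> set (words I)"
  using words[of I] by simp

lemma squash_eq_iff: "squash ws = I \<longleftrightarrow> filter (\<lambda>w. w \<noteq> []) ws = words I"
  by (metis words_inverse words_squash)

lemma filter_words [simp]: "filter (\<lambda>w. w \<noteq> []) (words I) = words I"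
  by (rule filter_True) (metis Nil_notin_words)

lemma squash_words [simp]: "squash (words I) = I"
  by (simp add: squash_eq_iff)

lemma squash_append: "squash (xs @ ys) = squash xs + squash ys"
  by (simp add: squash_eq_iff plus_sentence.rep_eq)

lemma squash_Nil [simp]: "squash [] = 0"
  by (simp add: squash_eq_iff zero_sentence.rep_eq)

lemma squash_Nil_word [simp]: "squash [[]] = 0"
  by (simp add: squash_eq_iff zero_sentence.rep_eq)

definition msent :: "'a monomial \<Rightarrow> 'a sentence" where
  "msent m = squash (map (proj m) (sorted_list_of_set (supp m)))"

lemma words_msent: "words (msent m) = map (proj m) (sorted_list_of_set (supp m))"
  unfolding msent_def words_squash
proof (intro filter_True ballI)
  fix w assume "w \<in> set (map (proj m) (sorted_list_of_set (supp m)))"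
  then have "w \<in> proj m ` supp m" by (simp only: set_map set_sorted_list_of_set[OF finite_supp])
  then show "w \<noteq> []" by (auto simp: supp_def)
qed

lemma filter_sorted_eq_sorted_list_of_set:
  assumes "sorted_wrt (<) js" "supp m \<subseteq> set js"
  shows "filter (\<lambda>j. proj m j \<noteq> []) js = sorted_list_of_set (supp m)"
proof -
  have "sorted (filter (\<lambda>j. proj m j \<noteq> []) js)" "distinct (filter (\<lambda>j. proj m j \<noteq> []) js)"
    using assms(1) by (auto simp: strict_sorted_iff sorted_wrt_filter)
  moreover have "set (filter (\<lambda>j. proj m j \<noteq> []) js) = supp m"
    using assms(2) by (auto simp: supp_def)
  ultimately show ?thesis by (metis sorted_list_of_set.idem_if_sorted_distinct)
qed

text \<open>Indices outside the support carry empty words, which \<open>squash\<close> discards.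
  Hence the factors of a monomial can be read along a common index list although their supports
  differ.\<close>

lemma msent_eq_squash:
  assumes "sorted_wrt (<) js" "supp m \<subseteq> set js"
  shows "msent m = squash (map (proj m) js)"
proof -
  have "words (msent m) = map (proj m) (filter (\<lambda>j. proj m j \<noteq> []) js)"
    by (simp only: words_msent filter_sorted_eq_sorted_list_of_set[OF assms])
  also have "\<dots> = words (squash (map (proj m) js))"
    by (simp only: words_squash filter_map o_def)
  finally show ?thesis by (simp only: words_inject)
qed

lemma card_subset_singleton: "A \<subseteq> {x} \<Longrightarrow> card A = of_bool (x \<in> A)"
  by (drule subset_singletonD) auto

text \<open>The words of \<open>I\<close> are nonempty, so an index sequence producing
  \<open>m\<close> must be the sorted support of \<open>m\<close>; there is at most one. The
  condition on 0 reflects that indices start at 1.\<close>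

lemma pcoeff_qM: "pcoeff (qM I) m = of_bool (0 \<notin> supp m \<and> msent m = I)"
proof -
  let ?S = "{js. length js = slen I \<and> sorted_wrt (<) js \<and> (\<forall>j\<in>set js. 1 \<le> j) \<and>
    prod_list (map2 var_word (words I) js) = m}"
  let ?s = "sorted_list_of_set (supp m)"
  have *: "js = ?s" if "js \<in> ?S" for js
  proof -
    have js: "length (words I) = length js" "distinct js" "sorted_wrt (<) js" "mono_of (words I) js = m"
      using that by (auto simp: slen_def mono_of_def strict_sorted_iff)
    then have "supp m \<subseteq> set js" "map (proj m) js = words I"
      using mono_of_eq_iff[OF js(1,2), of m] by auto
    moreover from this(2) have "filter (\<lambda>j. proj m j \<noteq> []) js = js"
      by (intro filter_True) (metis Nil_notin_words image_eqI image_set)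
    ultimately show ?thesis using filter_sorted_eq_sorted_list_of_set[OF js(3), of m] by simp
  qed
  have "?s \<in> ?S \<longleftrightarrow> 0 \<notin> supp m \<and> msent m = I"
  proof -
    have "prod_list (map2 var_word (words I) ?s) = m \<longleftrightarrow> msent m = I" if "length ?s = slen I"
      using mono_of_eq_iff[of "words I" ?s m] that
      by (auto simp: slen_def mono_of_def words_msent[symmetric] words_inject)
    moreover have "length ?s = slen I" if "msent m = I"
      using that words_msent[of m] by (auto simp: slen_def)
    moreover have "(\<forall>j\<in>supp m. Suc 0 \<le> j) \<longleftrightarrow> 0 \<notin> supp m"
      by (metis not_less_eq_eq le_zero_eq)
    ultimately show ?thesis by auto
  qed
  moreover have "card ?S = of_bool (?s \<in> ?S)"
    by (rule card_subset_singleton, rule subsetI, simp only: singleton_iff, rule *)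
  ultimately have "card ?S = of_bool (0 \<notin> supp m \<and> msent m = I)" by (simp only:)
  then show ?thesis by (simp only: qM_def Pseries_inverse[OF UNIV_I] of_nat_of_bool)
qed

section \<open>Test monomials, linear independence and coordinates\<close>

definition canon :: "'a sentence \<Rightarrow> 'a monomial" where
  "canon I = mono_of (words I) [1..<Suc (slen I)]"

lemma zero_notin_supp_canon [simp]: "0 \<notin> supp (canon I)"
  using supp_mono_of_subset by (fastforce simp: canon_def)

lemma msent_canon [simp]: "msent (canon I) = I"
proof -
  have "msent (canon I) = squash (map (proj (canon I)) [1..<Suc (slen I)])"
    using supp_mono_of_subset[of "words I" "[1..<Suc (slen I)]"]
    by (intro msent_eq_squash) (simp_all add: canon_def del: upt_Suc)
  then show ?thesis
    using map_proj_mono_of[of "words I" "[1..<Suc (slen I)]"]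
    by (simp add: canon_def slen_def del: upt_Suc)
qed

text \<open>The coefficient at \<open>canon K\<close> thus serves as the coordinate functional of
  the basis vector \<open>qM K\<close>.\<close>

lemma pcoeff_qM_canon: "pcoeff (qM I) (canon K) = of_bool (I = K)"
  by (auto simp: pcoeff_qM)

lemma inj_qM: "inj qM"
proof (rule injI)
  fix I K :: "'a sentence"
  assume "qM I = qM K"
  then have "pcoeff (qM I) (canon K) = pcoeff (qM K) (canon K)" by simp
  then show "I = K" by (simp add: pcoeff_qM_canon split: if_splits)
qed

lemma pcoeff_sum: "pcoeff (\<Sum>x\<in>X. f x) m = (\<Sum>x\<in>X. pcoeff (f x) m)"
  by (induction X rule: infinite_finite_induct) (auto simp: zero_pseries.rep_eq plus_pseries.rep_eq)

lemma pcoeff_pscale [simp]: "pcoeff (pscale c f) m = c * pcoeff f m"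
  by (simp add: pscale.rep_eq)

lemma independent_qM: "pseries.independent (range qM)"
  unfolding pseries.independent_explicit_module
proof (intro allI impI)
  fix t :: "'a pseries set" and u v
  assume t: "finite t" "t \<subseteq> range qM" "(\<Sum>v\<in>t. pscale (u v) v) = 0" "v \<in> t"
  then obtain K where K: "v = qM K" by auto
  have "0 = pcoeff (\<Sum>v\<in>t. pscale (u v) v) (canon K)"
    using t(3) by (simp add: zero_pseries.rep_eq)
  also have "\<dots> = (\<Sum>x\<in>t. if x = v then u v else 0)"
    unfolding pcoeff_sum
  proof (rule sum.cong)
    fix x assume "x \<in> t"
    then obtain I where "x = qM I" using t by auto
    then show "pcoeff (pscale (u x) x) (canon K) = (if x = v then u v else 0)"
      by (simp add: pcoeff_qM_canon K inj_eq[OF inj_qM])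
  qed simp
  also have "\<dots> = u v" using t by simp
  finally show "u v = 0" by simp
qed

text \<open>Both sides are linear in \<open>G\<close> and agree on the basis. This replaces the
  abstract \<open>representation\<close> by a coefficient.\<close>

lemma representation_qM:
  assumes "G \<in> QSym"
  shows "pseries.representation (range qM) G (qM I) = pcoeff G (canon I)"
proof -
  let ?r = "\<lambda>x. pseries.representation (range qM) x (qM I)"
  \<comment> \<open>Span membership is carried through the induction because
    \<open>representation_add\<close> requires it of both summands.\<close>
  have "G \<in> pseries.span (range qM) \<and> ?r G = pcoeff G (canon I)"
  proof (rule pseries.span_induct_alt[OF assms[unfolded QSym_def]])
    show "0 \<in> pseries.span (range qM) \<and> ?r 0 = pcoeff 0 (canon I)"
      by (simp only: pseries.representation_zero zero_pseries.rep_eq pseries.span_zero)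
  next
    fix c x y
    assume x: "x \<in> range (qM :: 'a sentence \<Rightarrow> 'a pseries)"
      and y: "y \<in> pseries.span (range qM) \<and> ?r y = pcoeff y (canon I)"
    obtain K where K: "x = qM K" using x by auto
    have span: "pscale c x \<in> pseries.span (range qM)"
      using x by (intro pseries.span_base pseries.span_scale)
    have "?r (pscale c x + y) = ?r (pscale c x) + ?r y"
      by (simp only: pseries.representation_add[OF independent_qM conjunct1[OF y] span])
    also have "?r (pscale c x) = c * ?r x"
      by (simp only: pseries.representation_scale[OF independent_qM pseries.span_base[OF x]])
    also have "?r x = of_bool (K = I)"
      using pseries.representation_basis[OF independent_qM x] by (simp add: K inj_eq[OF inj_qM])
    finally show "pscale c x + y \<in> pseries.span (range qM) \<and>
        ?r (pscale c x + y) = pcoeff (pscale c x + y) (canon I)"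
      using y pseries.span_add[OF span conjunct1[OF y]]
      by (simp only: K pcoeff_qM_canon pcoeff_pscale plus_pseries.rep_eq)
  qed
  then show ?thesis ..
qed

lemma pairing_QSym:
  "G \<in> QSym \<Longrightarrow> pairing F G =
    (\<Sum>I\<in>Poly_Mapping.keys F. Poly_Mapping.lookup F I * pcoeff G (canon I))"
  by (simp add: pairing_def representation_qM)

lemma pairing_qM: "pairing F (qM K) = Poly_Mapping.lookup F K"
proof -
  have "pairing F (qM K) = (\<Sum>I\<in>Poly_Mapping.keys F. if I = K then Poly_Mapping.lookup F I else 0)"
    by (subst pairing_QSym) (auto simp: QSym_def pseries.span_base pcoeff_qM_canon intro!: sum.cong)
  then show ?thesis by (simp add: in_keys_iff)
qed

section \<open>Cuts of words, quasi-shuffles and products of monomial functions\<close>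

definition merge :: "('a list \<times> 'a list) list \<Rightarrow> 'a list list" where
  "merge B = map (\<lambda>(p, q). p @ q) B"

text \<open>Each pair cuts one word into a prefix and a suffix, either of which may be
  empty.\<close>

definition splits :: "'a list list \<Rightarrow> ('a list \<times> 'a list) list set" where
  "splits ws = {B. merge B = ws}"

lemma finite_pair_splits [simp]: "finite {(p, q). p @ q = (w :: 'a list)}"
proof -
  have "{(p, q). p @ q = w} \<subseteq> (\<lambda>n. (take n w, drop n w)) ` {..length w}"
  proof clarify
    fix p q :: "'a list"
    assume "w = p @ q"
    then show "(p, q) \<in> (\<lambda>n. (take n (p @ q), drop n (p @ q))) ` {..length (p @ q)}"
      by (intro image_eqI[where x = "length p"]) simp_all
  qed
  then show ?thesis by (rule finite_subset) simp
qed

lemma splits_Nil: "splits [] = {[]}"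
  by (auto simp: splits_def merge_def)

lemma splits_Cons:
  "splits (w # ws) = (\<lambda>(x, B). x # B) ` ({(p, q). p @ q = w} \<times> splits ws)"
  by (force simp: splits_def merge_def Cons_eq_map_conv)

lemma finite_splits [simp]: "finite (splits ws)"
  by (induction ws) (auto simp: splits_Nil splits_Cons)

text \<open>Pairs of empty words are excluded: they would make this set infinite.\<close>

definition shuffles_of :: "'a sentence \<Rightarrow> 'a sentence \<Rightarrow> ('a list \<times> 'a list) list set" where
  "shuffles_of K S = {B. ([], []) \<notin> set B \<and> squash (map fst B) = K \<and> squash (map snd B) = S}"

text \<open>Every pair uses up a word of \<open>K\<close> or of \<open>S\<close>, which bounds the
  length, and the components come from a finite set.\<close>

lemma finite_shuffles_of: "finite (shuffles_of K S)"
proof -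
  let ?W = "insert [] (set (words K)) \<times> insert [] (set (words S))"
  have "set B \<subseteq> ?W \<and> length B \<le> slen K + slen S" if "B \<in> shuffles_of K S" for B
  proof -
    have B: "([], []) \<notin> set B" "filter (\<lambda>w. w \<noteq> []) (map fst B) = words K"
        "filter (\<lambda>w. w \<noteq> []) (map snd B) = words S"
      using that by (auto simp: shuffles_of_def squash_eq_iff)
    have "length B \<le> length (filter (\<lambda>w. w \<noteq> []) (map fst B)) + length (filter (\<lambda>w. w \<noteq> []) (map snd B))"
      using B(1) by (induction B) auto
    moreover have "set B \<subseteq> ?W"
      unfolding B(2,3)[symmetric] by (force simp: mem_Times_iff)
    ultimately show ?thesis unfolding B by (simp add: slen_def)
  qed
  then have "shuffles_of K S \<subseteq> {B. set B \<subseteq> ?W \<and> length B \<le> slen K + slen S}" by blast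
  then show ?thesis
    by (rule finite_subset) (intro finite_lists_length_le, simp)
qed

text \<open>Without pairs of empty words, merging yields no empty word and \<open>squash\<close>
  changes nothing; conversely, the words of \<open>I\<close> are nonempty, which excludes such
  pairs. So quasi-shuffles merging to \<open>I\<close> are cuts of \<open>I\<close>.\<close>

lemma shuffles_of_inter_splits:
  "{B \<in> shuffles_of K S. squash (merge B) = I}
    = {B \<in> splits (words I). squash (map fst B) = K \<and> squash (map snd B) = S}"
proof -
  have *: "filter (\<lambda>w. w \<noteq> []) (merge B) = merge B" if "([], []) \<notin> set B" for B :: "('a list \<times> 'a list) list"
    using that by (intro filter_True) (auto simp: merge_def)
  have "([], []) \<notin> set B" if "merge B = words I" for B
  proof
    assume "([], []) \<in> set B"
    then have "[] \<in> set (merge B)" by (force simp: merge_def)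
    then show False using that by simp
  qed
  with * show ?thesis
    by (fastforce simp: shuffles_of_def splits_def squash_eq_iff)
qed

text \<open>By \<open>proj_times\<close>, factoring \<open>m\<close> amounts to cutting the word at
  each index independently; \<open>mono_of\<close> rebuilds the factors.\<close>

lemma bij_betw_splits:
  assumes "distinct js" "supp m \<subseteq> set js"
  shows "bij_betw (\<lambda>(p, q). map (\<lambda>i. (proj p i, proj q i)) js) {(p, q). p * q = m}
    (splits (map (proj m) js))"
proof (rule bij_betw_byWitness[where f' = "\<lambda>B. (mono_of (map fst B) js, mono_of (map snd B) js)"])
  show "\<forall>x\<in>{(p, q). p * q = m}. (\<lambda>B. (mono_of (map fst B) js, mono_of (map snd B) js))
      ((\<lambda>(p, q). map (\<lambda>i. (proj p i, proj q i)) js) x) = x"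
    using assms(2) by (clarsimp simp: o_def mono_of_eq_iff assms(1) supp_times)
  have inv: "map (\<lambda>i. (proj (mono_of (map fst B) js) i, proj (mono_of (map snd B) js) i)) js = B"
    if "B \<in> splits (map (proj m) js)" for B
  proof -
    have len: "length B = length js"
      using that unfolding splits_def merge_def by (metis (mono_tags) length_map mem_Collect_eq)
    then have "map (proj (mono_of (map fst B) js)) js = map fst B"
        "map (proj (mono_of (map snd B) js)) js = map snd B"
      using assms(1) by (auto intro!: map_proj_mono_of)
    then show ?thesis using len
      by (auto simp: list_eq_iff_nth_eq prod_eq_iff)
  qed
  then show "\<forall>B\<in>splits (map (proj m) js). (\<lambda>(p, q). map (\<lambda>i. (proj p i, proj q i)) js)
      (mono_of (map fst B) js, mono_of (map snd B) js) = B"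
    by simp
  show "(\<lambda>(p, q). map (\<lambda>i. (proj p i, proj q i)) js) ` {(p, q). p * q = m} \<subseteq> splits (map (proj m) js)"
    by (auto simp: splits_def merge_def)
  show "(\<lambda>B. (mono_of (map fst B) js, mono_of (map snd B) js)) ` splits (map (proj m) js) \<subseteq> {(p, q). p * q = m}"
  proof clarsimp
    fix B assume B: "B \<in> splits (map (proj m) js)"
    let ?m = "mono_of (map fst B) js * mono_of (map snd B) js"
    have "map (proj ?m) js = merge (map (\<lambda>i. (proj (mono_of (map fst B) js) i, proj (mono_of (map snd B) js) i)) js)"
      by (simp add: merge_def)
    also have "\<dots> = map (proj m) js"
      using inv[OF B] B by (simp add: splits_def)
    finally have "proj ?m i = proj m i" for i
      using assms(2) by (cases "i \<in> set js") (auto simp: proj_mono_of_notin proj_eq_Nil_if_notin[of m])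
    then show "?m = m" by (intro proj_eqI ext)
  qed
qed

lemma pcoeff_times: "pcoeff (f * g) m = (\<Sum>(p, q) | p * q = m. pcoeff f p * pcoeff g q)"
  by (simp add: times_pseries.rep_eq)

text \<open>Compare coefficients at \<open>m\<close>: factorizations of \<open>m\<close> become cuts
  of \<open>msent m\<close>, which are the quasi-shuffles merging to \<open>msent m\<close>.\<close>

lemma qM_times_qM: "qM K * qM S = (\<Sum>B\<in>shuffles_of K S. qM (squash (merge B)))"
proof (rule pseries_eqI)
  fix m :: "'a monomial"
  let ?js = "sorted_list_of_set (supp m)"
  let ?c = "\<lambda>B. of_bool (squash (map fst B) = K \<and> squash (map snd B) = S) :: rat"
  have js: "sorted_wrt (<) ?js" "distinct ?js" "set ?js = supp m" by auto
  have "pcoeff (qM K * qM S) m = (\<Sum>(p, q) | p * q = m. of_bool (0 \<notin> supp m) *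
      ?c (map (\<lambda>i. (proj p i, proj q i)) ?js))"
    unfolding pcoeff_times
  proof (intro sum.cong refl, clarify)
    fix p q assume m: "m = p * q"
    \<comment> \<open>The supports of \<open>p\<close> and \<open>q\<close> lie in that of
      \<open>m\<close>, so both are read along the same index list.\<close>
    have "msent p = squash (map (proj p) ?js)" "msent q = squash (map (proj q) ?js)"
      using js by (auto intro!: msent_eq_squash simp: m supp_times simp del: sorted_list_of_set_nonempty)
    then show "pcoeff (qM K) p * pcoeff (qM S) q =
        of_bool (0 \<notin> supp (p * q)) * ?c (map (\<lambda>i. (proj p i, proj q i)) (sorted_list_of_set (supp (p * q))))"
      by (auto simp: pcoeff_qM supp_times m o_def)
  qed
  also have "\<dots> = (\<Sum>B\<in>splits (map (proj m) ?js). of_bool (0 \<notin> supp m) * ?c B)"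
    by (subst sum.reindex_bij_betw[OF bij_betw_splits[OF js(2)], of m, symmetric])
      (auto simp: case_prod_unfold)
  also have "\<dots> = (\<Sum>B\<in>{B \<in> splits (words (msent m)). squash (map fst B) = K \<and> squash (map snd B) = S}.
      of_bool (0 \<notin> supp m))"
    unfolding words_msent
    by (subst sum.inter_filter) (simp, intro sum.cong, auto)
  also have "\<dots> = (\<Sum>B\<in>{B \<in> shuffles_of K S. squash (merge B) = msent m}. of_bool (0 \<notin> supp m))"
    by (simp only: shuffles_of_inter_splits)
  also have "\<dots> = (\<Sum>B\<in>shuffles_of K S. of_bool (0 \<notin> supp m \<and> squash (merge B) = msent m))"
    by (subst sum.inter_filter) (simp add: finite_shuffles_of, intro sum.cong, auto)
  also have "\<dots> = pcoeff (\<Sum>B\<in>shuffles_of K S. qM (squash (merge B))) m"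
    by (simp only: pcoeff_sum pcoeff_qM eq_commute)
  finally show "pcoeff (qM K * qM S) m = pcoeff (\<Sum>B\<in>shuffles_of K S. qM (squash (merge B))) m" .
qed

lemma qM_times_qM_in_QSym: "qM K * qM S \<in> QSym"
  unfolding qM_times_qM QSym_def by (intro pseries.span_sum pseries.span_base) simp

lemma pcoeff_qM_times_qM_canon:
  "pcoeff (qM K * qM S) (canon I)
    = of_nat (card {B \<in> splits (words I). squash (map fst B) = K \<and> squash (map snd B) = S})"
proof -
  have "pcoeff (qM K * qM S) (canon I) = (\<Sum>B\<in>shuffles_of K S. of_bool (squash (merge B) = I))"
    by (simp add: qM_times_qM pcoeff_sum pcoeff_qM_canon)
  also have "\<dots> = of_nat (card {B \<in> shuffles_of K S. squash (merge B) = I})"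
    by (simp add: of_bool_def sum.inter_filter[symmetric] finite_shuffles_of)
  finally show ?thesis by (simp only: shuffles_of_inter_splits)
qed

section \<open>The right perp operators\<close>

definition perp :: "'a sentence \<Rightarrow> 'a nsym \<Rightarrow> 'a nsym" where
  "perp S F = (\<Sum>I\<in>Poly_Mapping.keys F. \<Sum>B | B \<in> splits (words I) \<and> squash (map snd B) = S.
     Poly_Mapping.single (squash (map fst B)) (Poly_Mapping.lookup F I))"

lemma lookup_nscale [simp]: "Poly_Mapping.lookup (nscale c F) I = c * Poly_Mapping.lookup F I"
  unfolding nscale_def by (simp add: Poly_Mapping.map.rep_eq when_def)

lemma vector_space_nscale: "vector_space nscale"
  by standard (auto intro!: poly_mapping_eqI simp: lookup_add algebra_simps)

text \<open>The set of keys depends on \<open>F\<close>; a common superset makes linearity a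
  termwise statement.\<close>

lemma perp_superset:
  assumes "finite X" "Poly_Mapping.keys F \<subseteq> X"
  shows "perp S F = (\<Sum>I\<in>X. \<Sum>B | B \<in> splits (words I) \<and> squash (map snd B) = S.
     Poly_Mapping.single (squash (map fst B)) (Poly_Mapping.lookup F I))"
  unfolding perp_def using assms
  by (intro sum.mono_neutral_left) (auto simp: in_keys_iff)

lemma perp_zero [simp]: "perp S 0 = 0"
  by (simp add: perp_def)

lemma perp_add: "perp S (F + G) = perp S F + perp S G"
proof -
  let ?X = "Poly_Mapping.keys F \<union> Poly_Mapping.keys G"
  have "Poly_Mapping.keys (F + G) \<subseteq> ?X" by (rule keys_add)
  then show ?thesis
    by (simp add: perp_superset[of ?X] lookup_add single_add sum.distrib)
qed

lemma perp_nscale: "perp S (nscale c F) = nscale c (perp S F)"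
proof -
  have "Poly_Mapping.keys (nscale c F) \<subseteq> Poly_Mapping.keys F"
    by (auto simp: in_keys_iff)
  then have "perp S (nscale c F) = (\<Sum>I\<in>Poly_Mapping.keys F.
      \<Sum>B | B \<in> splits (words I) \<and> squash (map snd B) = S.
      Poly_Mapping.single (squash (map fst B)) (c * Poly_Mapping.lookup F I))"
    by (simp add: perp_superset[of "Poly_Mapping.keys F"])
  also have "\<dots> = nscale c (perp S F)"
    by (rule poly_mapping_eqI)
      (simp add: perp_def lookup_sum lookup_single sum_distrib_left mult_when)
  finally show ?thesis .
qed

lemma lookup_perp:
  "Poly_Mapping.lookup (perp S F) K =
    (\<Sum>I\<in>Poly_Mapping.keys F. Poly_Mapping.lookup F I *
      of_nat (card {B \<in> splits (words I). squash (map fst B) = K \<and> squash (map snd B) = S}))"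
  unfolding perp_def lookup_sum
proof (intro sum.cong refl)
  fix I
  let ?A = "{B. B \<in> splits (words I) \<and> squash (map snd B) = S}"
  have fin: "finite ?A" by (rule finite_subset[of _ "splits (words I)"]) auto
  have "(\<Sum>B\<in>?A. Poly_Mapping.lookup (Poly_Mapping.single (squash (map fst B)) (Poly_Mapping.lookup F I)) K)
     = (\<Sum>B\<in>{B \<in> ?A. squash (map fst B) = K}. Poly_Mapping.lookup F I)"
    by (subst sum.inter_filter) (use fin in \<open>auto simp: lookup_single when_def intro!: sum.cong\<close>)
  also have "{B \<in> ?A. squash (map fst B) = K} =
      {B \<in> splits (words I). squash (map fst B) = K \<and> squash (map snd B) = S}" by auto
  finally show "(\<Sum>B\<in>?A. Poly_Mapping.lookup (Poly_Mapping.single (squash (map fst B)) (Poly_Mapping.lookup F I)) K)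
     = Poly_Mapping.lookup F I *
      of_nat (card {B \<in> splits (words I). squash (map fst B) = K \<and> squash (map snd B) = S})"
    by (simp add: mult.commute)
qed

text \<open>Both sides count, weighted by the coefficients of \<open>F\<close>, the cuts whose
  prefixes form \<open>K\<close> and whose suffixes form \<open>S\<close>.\<close>

lemma pairing_perp_qM: "pairing (perp S F) (qM K) = pairing F (qM K * qM S)"
  by (simp add: pairing_qM lookup_perp pairing_QSym[OF qM_times_qM_in_QSym] pcoeff_qM_times_qM_canon)

section \<open>Adjointness on all of \<open>QSym\<close> and identification of the perp
  operator\<close>

lemma QSym_zero: "0 \<in> QSym"
  unfolding QSym_def by (rule pseries.span_zero)

lemma QSym_add: "f \<in> QSym \<Longrightarrow> g \<in> QSym \<Longrightarrow> f + g \<in> QSym"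
  unfolding QSym_def by (rule pseries.span_add)

lemma QSym_scale: "f \<in> QSym \<Longrightarrow> pscale c f \<in> QSym"
  unfolding QSym_def by (rule pseries.span_scale)

lemma QSym_qM: "qM I \<in> QSym"
  unfolding QSym_def by (intro pseries.span_base) simp

lemma pairing_zero_right: "pairing F 0 = 0"
  by (simp add: pairing_QSym QSym_zero zero_pseries.rep_eq)

lemma pairing_add_right:
  "f \<in> QSym \<Longrightarrow> g \<in> QSym \<Longrightarrow> pairing F (f + g) = pairing F f + pairing F g"
  by (simp add: pairing_QSym QSym_add plus_pseries.rep_eq algebra_simps sum.distrib)

lemma pairing_scale_right: "f \<in> QSym \<Longrightarrow> pairing F (pscale c f) = c * pairing F f"
  by (simp add: pairing_QSym QSym_scale sum_distrib_left mult.left_commute)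

lemma pscale_times: "pscale c f * g = pscale c (f * g)"
  by (rule pseries_eqI) (simp add: pcoeff_times sum_distrib_left case_prod_unfold mult.assoc)

lemma pairing_perp:
  assumes "G \<in> QSym"
  shows "pairing (perp S F) G = pairing F (G * qM S)"
proof -
  \<comment> \<open>The induction carries both memberships since \<open>pairing_add_right\<close>
    holds for arguments in \<open>QSym\<close>.\<close>
  have "G \<in> QSym \<and> G * qM S \<in> QSym \<and> pairing (perp S F) G = pairing F (G * qM S)"
  proof (rule pseries.span_induct_alt[OF assms[unfolded QSym_def]])
    show "0 \<in> QSym \<and> 0 * qM S \<in> QSym \<and> pairing (perp S F) 0 = pairing F (0 * qM S)"
      by (simp add: QSym_zero pairing_zero_right)
  next
    fix c x y
    assume "x \<in> range (qM :: 'a sentence \<Rightarrow> 'a pseries)"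
      and "y \<in> QSym \<and> y * qM S \<in> QSym \<and> pairing (perp S F) y = pairing F (y * qM S)"
    then show "pscale c x + y \<in> QSym \<and> (pscale c x + y) * qM S \<in> QSym \<and>
        pairing (perp S F) (pscale c x + y) = pairing F ((pscale c x + y) * qM S)"
      by (auto simp: distrib_right pscale_times QSym_qM QSym_add QSym_scale pairing_add_right
          pairing_scale_right qM_times_qM_in_QSym pairing_perp_qM)
  qed
  then show ?thesis by blast
qed

lemma linear_perp: "Vector_Spaces.linear nscale nscale (perp S)"
  unfolding Vector_Spaces.linear_def module_hom_def module_hom_axioms_def
  using vector_space_nscale
  by (auto simp: perp_add perp_nscale vector_space_def module_def)

text \<open>Uniqueness in the definite description: pairing with every \<open>qM K\<close> recovers
  all coefficients of \<open>T F\<close>.\<close>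

lemma perp_r_qM: "perp_r (qM S) = perp S"
  unfolding perp_r_def
proof (rule the_equality)
  fix T :: "'a nsym \<Rightarrow> 'a nsym"
  assume "Vector_Spaces.linear nscale nscale T \<and>
    (\<forall>F. \<forall>G\<in>QSym. pairing (T F) G = pairing F (G * qM S))"
  then have "Poly_Mapping.lookup (T F) K = Poly_Mapping.lookup (perp S F) K" for F K
    using pairing_perp[of "qM K" S F] by (simp add: QSym_qM flip: pairing_qM)
  then show "T = perp S" by (intro ext poly_mapping_eqI)
qed (simp add: linear_perp pairing_perp)

section \<open>Bernstein operators as finite sums\<close>

text \<open>Compositions of a word. They bound the sets of coarsenings and refinements, and later
  describe the refinements of one appended word.\<close>

definition comps :: "'b list \<Rightarrow> 'b list list set" where
  "comps w = {Q. [] \<notin> set Q \<and> concat Q = w}"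

lemma finite_comps [simp]: "finite (comps w)"
proof -
  have "length Q \<le> length (concat Q)" if "[] \<notin> set Q" for Q :: "'b list list"
    using that
  proof (induction Q)
    case (Cons b Q)
    then show ?case by (cases b) auto
  qed simp
  moreover have "set b \<subseteq> set (concat Q) \<and> length b \<le> length (concat Q)" if "b \<in> set Q"
    for b :: "'b list" and Q
    using that by (auto simp: length_concat intro: member_le_sum_list)
  ultimately have "comps w \<subseteq> {Q. set Q \<subseteq> {b. set b \<subseteq> set w \<and> length b \<le> length w} \<and> length Q \<le> length w}"
    unfolding comps_def by blast
  then show ?thesis
    by (rule finite_subset) (intro finite_lists_length_le finite_set)
qed

lemma comps_Nil: "comps [] = {[]}"
proof -
  have "Q = []" if "[] \<notin> set Q" "concat Q = []" for Q :: "'b list list"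
    using that by (cases Q) auto
  then show ?thesis by (auto simp: comps_def)
qed

lemma concat_words_coarsens: "Q \<preceq> S \<Longrightarrow> concat (words Q) = concat (words S)"
proof -
  have "concat (concat B) = concat (map concat B)" for B :: "'a list list list"
    by (induction B) auto
  then show "Q \<preceq> S \<Longrightarrow> concat (words Q) = concat (words S)"
    unfolding coarsens_def by metis
qed

lemma finite_coarsenings [simp]: "finite {S. Q \<preceq> S}"
proof -
  have "words ` {S. Q \<preceq> S} \<subseteq> comps (concat (words Q))"
    using concat_words_coarsens by (force simp: comps_def)
  then have "finite (words ` {S. Q \<preceq> S})" by (rule finite_subset) simp
  then show ?thesis by (rule finite_imageD) (simp add: inj_on_def words_inject)
qed

lemma finite_refinements [simp]: "finite {Q. Q \<preceq> S}"
proof -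
  have "words ` {Q. Q \<preceq> S} \<subseteq> comps (concat (words S))"
    using concat_words_coarsens by (force simp: comps_def)
  then have "finite (words ` {Q. Q \<preceq> S})" by (rule finite_subset) simp
  then show ?thesis by (rule finite_imageD) (simp add: inj_on_def words_inject)
qed

text \<open>Finiteness matters: the sum over \<open>Q\<close> in \<open>bernstein\<close> would
  otherwise be 0 by convention.\<close>

lemma finite_reverse_sentences: "finite {Q. concat (rev (words Q)) = u}"
proof -
  have "(\<lambda>Q. rev (words Q)) ` {Q. concat (rev (words Q)) = u} \<subseteq> comps u"
    by (auto simp: comps_def)
  then have "finite ((\<lambda>Q. rev (words Q)) ` {Q. concat (rev (words Q)) = u})" by (rule finite_subset) simp
  then show ?thesis by (rule finite_imageD) (simp add: inj_on_def words_inject)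
qed

section \<open>Exchanging the sums over refinements and coarsenings\<close>

definition bcoef :: "'a list \<Rightarrow> 'a sentence \<Rightarrow> 'a nsym" where
  "bcoef v S = (\<Sum>Q | Q \<preceq> S. (-1) ^ slen Q * H_word (v @ concat (rev (words Q))))"

text \<open>Only the suffix sentences of cuts of the keys of \<open>f\<close> can
  contribute.\<close>

lemma finite_perp_support: "finite {S. perp S f \<noteq> 0}"
proof -
  have "{S. perp S f \<noteq> 0} \<subseteq> (\<Union>I\<in>Poly_Mapping.keys f. (\<lambda>B. squash (map snd B)) ` splits (words I))"
  proof (rule subsetI, rule ccontr)
    fix S assume "S \<in> {S. perp S f \<noteq> 0}" and *: "S \<notin> (\<Union>I\<in>Poly_Mapping.keys f. (\<lambda>B. squash (map snd B)) ` splits (words I))"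
    have "perp S f = 0"
      unfolding perp_def
    proof (rule sum.neutral, rule ballI)
      fix I assume "I \<in> Poly_Mapping.keys f"
      then have none: "{B. B \<in> splits (words I) \<and> squash (map snd B) = S} = {}" using * by blast
      show "(\<Sum>B | B \<in> splits (words I) \<and> squash (map snd B) = S.
          Poly_Mapping.single (squash (map fst B)) (Poly_Mapping.lookup f I)) = 0"
        unfolding none by simp
    qed
    then show False using \<open>S \<in> {S. perp S f \<noteq> 0}\<close> by simp
  qed
  then show ?thesis by (rule finite_subset) simp
qed

text \<open>Since \<open>Q\<close> determines \<open>u\<close>, the two outer sums collapse to one
  over \<open>Q\<close>, which is then exchanged with the sum over \<open>S\<close>. Any finite
  \<open>A\<close> containing the support is allowed, so one \<open>A\<close> can serve two
  arguments in \<open>bernstein_add\<close>.\<close>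

lemma bernstein_eq_sum:
  fixes f :: "'a nsym"
  assumes A: "finite A" "{S. perp S f \<noteq> 0} \<subseteq> A"
  shows "bernstein v f = (\<Sum>S\<in>A. bcoef v S * perp S f)"
proof -
  define \<rho> where "\<rho> Q = concat (rev (words Q))" for Q :: "'a sentence"
  define t where "t u Q = (-1) ^ slen Q * H_word (v @ u) * (\<Sum>S | Q \<preceq> S. perp S f)" for u and Q :: "'a sentence"
  \<comment> \<open>Only refinements of members of \<open>A\<close> give nonzero terms; this set is
    finite, so the sums can be exchanged.\<close>
  define R where "R = (\<Union>S\<in>A. {Q. Q \<preceq> S})"
  have R: "finite R" using A by (auto simp: R_def)
  have inner: "(\<Sum>S | Q \<preceq> S. perp S f) = (\<Sum>S | S \<in> A \<and> Q \<preceq> S. perp S f)" for Q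
    by (rule sum.mono_neutral_right) (use A(2) in \<open>auto simp only: finite_coarsenings\<close>)
  have t0: "t u Q = 0" if "Q \<notin> R" for u Q
  proof -
    have "{S. S \<in> A \<and> Q \<preceq> S} = {}" using that by (auto simp: R_def)
    then show ?thesis unfolding t_def inner by (simp only: sum.empty mult_zero_right)
  qed
  have g: "(\<Sum>Q | \<rho> Q = u. t u Q) = (\<Sum>Q | Q \<in> R \<and> \<rho> Q = u. t (\<rho> Q) Q)" for u
  proof (rule sum.mono_neutral_cong_right)
    show "finite {Q. \<rho> Q = u}" unfolding \<rho>_def by (rule finite_reverse_sentences)
    show "\<forall>Q\<in>{Q. \<rho> Q = u} - {Q. Q \<in> R \<and> \<rho> Q = u}. t u Q = 0"
      by (intro ballI t0) blast
  qed auto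
  have "bernstein v f = Sum_any (\<lambda>u. \<Sum>Q | \<rho> Q = u. t u Q)"
    unfolding bernstein_def \<rho>_def t_def perp_r_qM ..
  also have "\<dots> = (\<Sum>u\<in>\<rho> ` R. \<Sum>Q | \<rho> Q = u. t u Q)"
  proof (rule Sum_any.expand_superset)
    show "{u. (\<Sum>Q | \<rho> Q = u. t u Q) \<noteq> 0} \<subseteq> \<rho> ` R"
    proof (rule subsetI, rule ccontr)
      fix u assume "u \<in> {u. (\<Sum>Q | \<rho> Q = u. t u Q) \<noteq> 0}" "u \<notin> \<rho> ` R"
      then have "{Q. Q \<in> R \<and> \<rho> Q = u} = {}" by blast
      then have "(\<Sum>Q | \<rho> Q = u. t u Q) = 0" unfolding g by (simp only: sum.empty)
      then show False using \<open>u \<in> _\<close> by simp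
    qed
  qed (use R in simp)
  also have "\<dots> = (\<Sum>Q\<in>R. t (\<rho> Q) Q)"
    unfolding g by (rule sum.image_gen[OF R, symmetric])
  also have "\<dots> = (\<Sum>Q\<in>R. \<Sum>S | S \<in> A \<and> Q \<preceq> S. (-1) ^ slen Q * H_word (v @ \<rho> Q) * perp S f)"
    unfolding t_def inner by (simp only: sum_distrib_left)
  also have "\<dots> = (\<Sum>S\<in>A. \<Sum>Q | Q \<in> R \<and> Q \<preceq> S. (-1) ^ slen Q * H_word (v @ \<rho> Q) * perp S f)"
    by (rule sum.swap_restrict) (use A R in auto)
  also have "\<dots> = (\<Sum>S\<in>A. bcoef v S * perp S f)"
  proof (rule sum.cong)
    fix S assume "S \<in> A"
    then have "{Q. Q \<in> R \<and> Q \<preceq> S} = {Q. Q \<preceq> S}" by (auto simp: R_def)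
    then show "(\<Sum>Q | Q \<in> R \<and> Q \<preceq> S. (-1) ^ slen Q * H_word (v @ \<rho> Q) * perp S f) = bcoef v S * perp S f"
      by (simp only: bcoef_def sum_distrib_right \<rho>_def)
  qed simp
  finally show ?thesis .
qed

lemma bernstein_zero [simp]: "bernstein v 0 = 0"
  using bernstein_eq_sum[of "{}" 0 v] by simp

lemma bernstein_add: "bernstein v (f + g) = bernstein v f + bernstein v g"
proof -
  let ?A = "{S. perp S f \<noteq> 0} \<union> {S. perp S g \<noteq> 0}"
  have "{S. perp S (f + g) \<noteq> 0} \<subseteq> ?A" by (auto simp: perp_add)
  then have "bernstein v (f + g) = (\<Sum>S\<in>?A. bcoef v S * perp S (f + g))"
    by (intro bernstein_eq_sum) (simp_all add: finite_perp_support)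
  also have "\<dots> = (\<Sum>S\<in>?A. bcoef v S * perp S f) + (\<Sum>S\<in>?A. bcoef v S * perp S g)"
    by (simp only: perp_add distrib_left sum.distrib)
  also have "(\<Sum>S\<in>?A. bcoef v S * perp S f) = bernstein v f"
    by (intro bernstein_eq_sum[symmetric]) (simp_all add: finite_perp_support)
  also have "(\<Sum>S\<in>?A. bcoef v S * perp S g) = bernstein v g"
    by (intro bernstein_eq_sum[symmetric]) (simp_all add: finite_perp_support)
  finally show ?thesis .
qed

lemma bernstein_sum: "bernstein v (\<Sum>x\<in>X. f x) = (\<Sum>x\<in>X. bernstein v (f x))"
  by (induction X rule: infinite_finite_induct) (simp_all add: bernstein_add)

lemma perp_single:
  "perp S (Poly_Mapping.single I c) =
    (\<Sum>B | B \<in> splits (words I) \<and> squash (map snd B) = S. Poly_Mapping.single (squash (map fst B)) c)"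
  by (subst perp_superset[of "{I}"]) auto

text \<open>Each cut determines its \<open>S\<close>, so the sum over \<open>S\<close> merely groups
  the cuts by suffix sentence.\<close>

lemma bernstein_single:
  "bernstein v (Poly_Mapping.single I c) =
    (\<Sum>B\<in>splits (words I). bcoef v (squash (map snd B)) * Poly_Mapping.single (squash (map fst B)) c)"
proof -
  let ?h = "\<lambda>B. squash (map snd B) :: 'a sentence"
  let ?A = "?h ` splits (words I)"
  have "{S. perp S (Poly_Mapping.single I c) \<noteq> 0} \<subseteq> ?A"
  proof (rule subsetI, rule ccontr)
    fix S assume S: "S \<in> {S. perp S (Poly_Mapping.single I c) \<noteq> 0}" "S \<notin> ?A"
    then have none: "{B. B \<in> splits (words I) \<and> ?h B = S} = {}" by blast
    have "perp S (Poly_Mapping.single I c) = 0" unfolding perp_single none by simp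
    then show False using S(1) by simp
  qed
  then have "bernstein v (Poly_Mapping.single I c) = (\<Sum>S\<in>?A. bcoef v S * perp S (Poly_Mapping.single I c))"
    by (intro bernstein_eq_sum) auto
  also have "\<dots> = (\<Sum>S\<in>?A. \<Sum>B | B \<in> splits (words I) \<and> ?h B = S.
      bcoef v (?h B) * Poly_Mapping.single (squash (map fst B)) c)"
    unfolding perp_single sum_distrib_left by (intro sum.cong) auto
  also have "\<dots> = (\<Sum>B\<in>splits (words I). bcoef v (?h B) * Poly_Mapping.single (squash (map fst B)) c)"
    by (rule sum.image_gen[symmetric]) simp
  finally show ?thesis .
qed

section \<open>The Pieri rule\<close>

lemma words_add_squash:
  "w \<noteq> [] \<Longrightarrow> words (I + squash [w]) = words I @ [w]"
  by (simp add: plus_sentence.rep_eq)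

text \<open>This covers the empty word: \<open>squash [[]]\<close> is the zero key, whose basis
  element is 1.\<close>

lemma H_word_eq_single: "H_word w = Poly_Mapping.single (squash [w]) 1"
  by (cases "w = []") (simp_all add: H_word_def H_sentence_def squash_def[of "[w]"])

text \<open>The last block of a refinement spells \<open>s\<close>, and the other blocks show that
  the rest refines \<open>S\<close>.\<close>

lemma refinements_add_word:
  fixes S :: "'a sentence"
  assumes "s \<noteq> []"
  shows "bij_betw (\<lambda>(Q1, Q2). Q1 + squash Q2) ({Q. Q \<preceq> S} \<times> comps s) {Q. Q \<preceq> S + squash [s]}"
  unfolding bij_betw_def
proof
  have words: "words (Q1 + squash Q2) = words Q1 @ Q2" if "Q2 \<in> comps s" for Q1 Q2
    using that by (auto simp: plus_sentence.rep_eq comps_def intro: filter_True)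
  \<comment> \<open>One of the two lists extends the other, by nonempty words whose concatenation is
    empty, hence by nothing.\<close>
  have prefix_eq: "words Q1 = words Q1'" if eq: "words Q1 @ Q2 = words Q1' @ Q2'"
      and "concat (words Q1) = concat (words Q1')" for Q1 Q1' :: "'a sentence" and Q2 Q2'
  proof -
    obtain us where "words Q1 = words Q1' @ us \<or> words Q1' = words Q1 @ us"
      using eq by (metis append_eq_append_conv2)
    moreover from this have "[] \<notin> set us"
      by (metis Nil_notin_words Un_iff set_append)
    moreover have "concat us = []"
      using calculation(1) that(2) by auto
    ultimately have "us \<in> comps []" by (simp add: comps_def)
    then have "us = []" by (simp add: comps_Nil)
    then show ?thesis using \<open>words Q1 = words Q1' @ us \<or> words Q1' = words Q1 @ us\<close> by auto
  qed
  show "inj_on (\<lambda>(Q1, Q2). Q1 + squash Q2) ({Q. Q \<preceq> S} \<times> comps s)"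
  proof (rule inj_onI, clarify)
    fix Q1 Q2 Q1' Q2'
    assume Q: "Q1 \<preceq> S" "Q1' \<preceq> S" "Q2 \<in> comps s" "Q2' \<in> comps s" and eq: "Q1 + squash Q2 = Q1' + squash Q2'"
    have *: "words Q1 @ Q2 = words Q1' @ Q2'"
      using arg_cong[OF eq, of words] by (simp only: words[OF Q(3)] words[OF Q(4)])
    have "words Q1 = words Q1'"
      by (rule prefix_eq[OF *]) (simp only: concat_words_coarsens[OF Q(1)] concat_words_coarsens[OF Q(2)])
    then show "Q1 = Q1' \<and> Q2 = Q2'" using * by (simp add: words_inject)
  qed
  show "(\<lambda>(Q1, Q2). Q1 + squash Q2) ` ({Q. Q \<preceq> S} \<times> comps s) = {Q. Q \<preceq> S + squash [s]}"
  proof (intro set_eqI iffI)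
    fix Q assume "Q \<in> (\<lambda>(Q1, Q2). Q1 + squash Q2) ` ({Q. Q \<preceq> S} \<times> comps s)"
    then obtain Q1 Q2 where Q: "Q = Q1 + squash Q2" "Q1 \<preceq> S" "Q2 \<in> comps s" by auto
    then obtain B where B: "[] \<notin> set B" "concat B = words Q1" "map concat B = words S"
      by (auto simp: coarsens_def)
    have "[] \<notin> set (B @ [Q2])" "concat (B @ [Q2]) = words Q" "map concat (B @ [Q2]) = words (S + squash [s])"
      using B Q assms by (auto simp: words words_add_squash comps_def)
    then show "Q \<in> {Q. Q \<preceq> S + squash [s]}" unfolding coarsens_def by blast
  next
    fix Q assume "Q \<in> {Q. Q \<preceq> S + squash [s]}"
    then obtain B where B: "[] \<notin> set B" "concat B = words Q" "map concat B = words S @ [s]"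
      by (auto simp: coarsens_def words_add_squash[OF assms])
    then obtain C b where C: "B = C @ [b]" "map concat C = words S" "concat b = s"
      by (auto simp: map_eq_append_conv)
    have "[] \<notin> set (concat C)" "[] \<notin> set b"
      using Nil_notin_words[of Q] unfolding B(2)[symmetric] C(1) by auto
    then have "words (Sentence (concat C)) = concat C" "b \<in> comps s"
      using C by (auto simp: Sentence_inverse comps_def)
    moreover from this have "Sentence (concat C) \<preceq> S"
      using B C by (auto simp: coarsens_def)
    moreover have "Q = Sentence (concat C) + squash b"
      using B C calculation words[of b "Sentence (concat C)"] by (simp flip: words_inject)
    ultimately show "Q \<in> (\<lambda>(Q1, Q2). Q1 + squash Q2) ` ({Q. Q \<preceq> S} \<times> comps s)"
      by (intro image_eqI[where x = "(Sentence (concat C), b)"]) simp_all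
  qed
qed

text \<open>Lengths add, which splits the sign, and \<open>rev\<close> puts the refinement
  \<open>Q\<close> of the last word directly after \<open>v\<close>. For empty \<open>s\<close> both
  sides are \<open>bcoef v S\<close>.\<close>

lemma bcoef_add_word:
  "bcoef v (S + squash [s]) = (\<Sum>Q\<in>comps s. (-1) ^ length Q * bcoef (v @ concat (rev Q)) S)"
proof (cases "s = []")
  case True
  then show ?thesis by (simp add: comps_Nil)
next
  case False
  have "bcoef v (S + squash [s]) = (\<Sum>(Q1, Q2)\<in>{Q. Q \<preceq> S} \<times> comps s.
      (-1) ^ slen (Q1 + squash Q2) * H_word (v @ concat (rev (words (Q1 + squash Q2)))))"
    unfolding bcoef_def
    by (subst sum.reindex_bij_betw[OF refinements_add_word[OF False], symmetric]) (simp add: case_prod_unfold)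
  also have "\<dots> = (\<Sum>(Q1, Q2)\<in>{Q. Q \<preceq> S} \<times> comps s.
      (-1) ^ length Q2 * ((-1) ^ slen Q1 * H_word ((v @ concat (rev Q2)) @ concat (rev (words Q1)))))"
  proof (intro sum.cong refl, clarify)
    fix Q1 Q2 assume "Q2 \<in> comps s"
    then have "words (Q1 + squash Q2) = words Q1 @ Q2"
      by (auto simp: plus_sentence.rep_eq comps_def intro: filter_True)
    then show "(-1) ^ slen (Q1 + squash Q2) * H_word (v @ concat (rev (words (Q1 + squash Q2)))) =
      (-1) ^ length Q2 * ((-1) ^ slen Q1 * H_word ((v @ concat (rev Q2)) @ concat (rev (words Q1))))"
      by (simp add: slen_def add.commute[of "length (words Q1)"]) (simp add: power_add mult.assoc)
  qed
  also have "\<dots> = (\<Sum>Q1 | Q1 \<preceq> S. \<Sum>Q2\<in>comps s.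
      (-1) ^ length Q2 * ((-1) ^ slen Q1 * H_word ((v @ concat (rev Q2)) @ concat (rev (words Q1)))))"
    by (simp only: sum.cartesian_product)
  also have "\<dots> = (\<Sum>Q2\<in>comps s. \<Sum>Q1 | Q1 \<preceq> S.
      (-1) ^ length Q2 * ((-1) ^ slen Q1 * H_word ((v @ concat (rev Q2)) @ concat (rev (words Q1)))))"
    by (rule sum.swap)
  finally show ?thesis unfolding bcoef_def by (simp only: sum_distrib_left)
qed

text \<open>The terms with \<open>x \<noteq> []\<close> cancel against those with \<open>x = []\<close>: append \<open>x\<close> to \<open>Q\<close>.\<close>

lemma sum_comps_cancel:
  fixes g :: "'b list \<Rightarrow> 'c :: ring_1"
  shows "(\<Sum>(s, x) | s @ x = t. \<Sum>Q\<in>comps s. (-1) ^ length Q * g (x @ concat (rev Q)))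
    = (if t = [] then g [] else 0)"
proof -
  let ?F = "\<lambda>Q. (-1) ^ length Q * g (concat (rev Q))"
  let ?f = "\<lambda>x Q. (-1) ^ length Q * g (x @ concat (rev Q))"
  let ?N = "{(s, x). s @ x = t \<and> x \<noteq> []}"
  have last: "concat (butlast R) @ last R = concat R" if "R \<noteq> []" for R :: "'b list list"
    by (metis append_butlast_last_id append_Nil2 concat.simps concat_append that)
  have fin: "finite ?N" by (rule finite_subset[OF _ finite_pair_splits[of t]]) auto
  have "(\<Sum>y\<in>?N. \<Sum>Q\<in>comps (fst y). ?f (snd y) Q) = (\<Sum>(y, Q)\<in>Sigma ?N (\<lambda>y. comps (fst y)). ?f (snd y) Q)"
    by (rule sum.Sigma) (use fin in auto)
  \<comment> \<open>\<open>Q @ [x]\<close> is one block longer than \<open>Q\<close>, hence the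
    sign; reversal puts \<open>x\<close> in front, so the argument of \<open>g\<close> is
    unchanged.\<close>
  also have "\<dots> = (\<Sum>R\<in>comps t - {[]}. - ?F R)"
    by (rule sum.reindex_bij_witness[of _ "\<lambda>R. ((concat (butlast R), last R), butlast R)" "\<lambda>(y, Q). Q @ [snd y]"])
      (auto simp: comps_def last dest: in_set_butlastD last_in_set)
  finally have N: "(\<Sum>y\<in>?N. \<Sum>Q\<in>comps (fst y). ?f (snd y) Q) = - (\<Sum>R\<in>comps t - {[]}. ?F R)"
    by (simp add: sum_negf)
  have "{(s, x). s @ x = t} = insert (t, []) ?N" by auto
  then have "(\<Sum>(s, x) | s @ x = t. \<Sum>Q\<in>comps s. ?f x Q) = (\<Sum>Q\<in>comps t. ?F Q) - (\<Sum>R\<in>comps t - {[]}. ?F R)"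
    using N fin by (simp add: case_prod_unfold)
  also have "\<dots> = (if t = [] then g [] else 0)"
    \<comment> \<open>For nonempty \<open>t\<close> the empty list is not in \<open>comps t\<close>
      and the sums cancel; for empty \<open>t\<close> only the empty composition is left.\<close>
    by (cases "t = []") (auto simp: comps_Nil, simp add: comps_def)
  finally show ?thesis .
qed

text \<open>The appended word is cut independently of the words of \<open>I\<close>. For empty
  \<open>w\<close> its only cut \<open>([], [])\<close> adds nothing to either sentence.\<close>

lemma sum_splits_add_word:
  "(\<Sum>B\<in>splits (words (I + squash [w])). \<phi> (squash (map fst B)) (squash (map snd B))) =
    (\<Sum>B\<in>splits (words I). \<Sum>(p, s) | p @ s = w.
      \<phi> (squash (map fst B) + squash [p]) (squash (map snd B) + squash [s]))"
proof (cases "w = []")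
  case True
  then have "{(p, s). p @ s = w} = {([], [])}" by auto
  then show ?thesis using True by simp
next
  case False
  have "splits (words I @ [w]) = (\<lambda>(B, x). B @ [x]) ` (splits (words I) \<times> {(p, s). p @ s = w})"
    by (force simp: splits_def merge_def map_eq_append_conv)
  moreover have "inj_on (\<lambda>(B, x). B @ [x]) (splits (words I) \<times> {(p, s). p @ s = w})"
    by (auto simp: inj_on_def)
  ultimately show ?thesis
    by (simp add: words_add_squash[OF False] sum.reindex sum.cartesian_product case_prod_unfold squash_append)
qed

text \<open>Both sides run over the cuts of \<open>w\<close> into three pieces \<open>p\<close>,
  \<open>s\<close>, \<open>x\<close>.\<close>

lemma sum_splits_assoc:
  "(\<Sum>(u, x) | u @ x = w. \<Sum>(p, s) | p @ s = u. f p s x) =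
    (\<Sum>(p, t) | p @ t = w. \<Sum>(s, x) | s @ x = t. f p s x)"
proof -
  have "(\<Sum>y\<in>{(u, x). u @ x = w}. \<Sum>z\<in>{(p, s). p @ s = fst y}. f (fst z) (snd z) (snd y))
    = (\<Sum>(y, z)\<in>Sigma {(u, x). u @ x = w} (\<lambda>y. {(p, s). p @ s = fst y}). f (fst z) (snd z) (snd y))"
    by (rule sum.Sigma) auto
  also have "\<dots> = (\<Sum>(y, z)\<in>Sigma {(p, t). p @ t = w} (\<lambda>y. {(s, x). s @ x = snd y}). f (fst y) (fst z) (snd z))"
    by (rule sum.reindex_bij_witness[of _
          "\<lambda>(y, z). ((fst y @ fst z, snd z), (fst y, fst z))"
          "\<lambda>(y, z). ((fst z, snd z @ snd y), (snd z, snd y))"]) auto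
  also have "\<dots> = (\<Sum>y\<in>{(p, t). p @ t = w}. \<Sum>z\<in>{(s, x). s @ x = snd y}. f (fst y) (fst z) (snd z))"
    by (rule sum.Sigma[symmetric]) auto
  finally show ?thesis by (simp add: case_prod_unfold)
qed

text \<open>The factor \<open>H_word u\<close> appends \<open>u\<close> to \<open>I\<close>; a cut
  \<open>u = p @ s\<close> sends \<open>p\<close> to the surviving key and \<open>s\<close> into
  \<open>bcoef\<close>. For fixed \<open>p\<close>, the sum over \<open>s\<close> and
  \<open>x\<close> cancels unless \<open>p = w\<close>.\<close>

lemma bernstein_single_mult_H_word:
  fixes I :: "'a sentence"
  shows "(\<Sum>(u, x) | u @ x = w. bernstein (v @ x) (Poly_Mapping.single I c * H_word u)) =
    bernstein v (Poly_Mapping.single I c) * H_word w"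
proof -
  let ?s = "\<lambda>B. squash (map snd B) :: 'a sentence" and ?p = "\<lambda>B. squash (map fst B) :: 'a sentence"
  let ?Z = "\<lambda>B p. Poly_Mapping.single (?p B + squash [p]) c"
  \<comment> \<open>\<open>bcoef_add_word\<close> turns \<open>s\<close> into a signed sum over
    compositions, so \<open>sum_comps_cancel\<close> applies with \<open>t = s @ x\<close>.\<close>
  have inner: "(\<Sum>(s, x) | s @ x = t. bcoef (v @ x) (S + squash [s]) * Z) = (if t = [] then bcoef v S * Z else 0)"
    for t S Z
  proof -
    have "(\<Sum>(s, x) | s @ x = t. bcoef (v @ x) (S + squash [s]) * Z) =
        (\<Sum>(s, x) | s @ x = t. \<Sum>Q\<in>comps s. (-1) ^ length Q * bcoef (v @ x @ concat (rev Q)) S) * Z"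
      unfolding sum_distrib_right by (intro sum.cong) (auto simp: bcoef_add_word)
    then show ?thesis
      using sum_comps_cancel[of "\<lambda>y. bcoef (v @ y) S" t] by simp
  qed
  have "(\<Sum>(u, x) | u @ x = w. bernstein (v @ x) (Poly_Mapping.single I c * H_word u)) =
      (\<Sum>(u, x) | u @ x = w. \<Sum>B\<in>splits (words I). \<Sum>(p, s) | p @ s = u. bcoef (v @ x) (?s B + squash [s]) * ?Z B p)"
    by (simp only: H_word_eq_single mult_single mult_1_right bernstein_single
        sum_splits_add_word[where \<phi> = "\<lambda>P S. bcoef (v @ _) S * Poly_Mapping.single P c"])
  also have "\<dots> = (\<Sum>B\<in>splits (words I). \<Sum>(u, x) | u @ x = w. \<Sum>(p, s) | p @ s = u. bcoef (v @ x) (?s B + squash [s]) * ?Z B p)"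
    unfolding case_prod_unfold by (rule sum.swap)
  also have "\<dots> = (\<Sum>B\<in>splits (words I). \<Sum>(p, t) | p @ t = w. \<Sum>(s, x) | s @ x = t. bcoef (v @ x) (?s B + squash [s]) * ?Z B p)"
    by (simp only: sum_splits_assoc)
  also have "\<dots> = (\<Sum>B\<in>splits (words I). \<Sum>(p, t) | p @ t = w. if t = [] then bcoef v (?s B) * ?Z B p else 0)"
    by (simp only: inner)
  also have "\<dots> = (\<Sum>B\<in>splits (words I). bcoef v (?s B) * ?Z B w)"
  proof (intro sum.cong refl)
    fix B
    \<comment> \<open>The condition \<open>t = []\<close> forces \<open>p = w\<close>, so a single
      pair survives.\<close>
    have "(\<Sum>(p, t) | p @ t = w. if t = [] then bcoef v (?s B) * ?Z B p else 0)
      = (\<Sum>y\<in>{(p, t). p @ t = w}. if y = (w, []) then bcoef v (?s B) * ?Z B w else 0)"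
      by (rule sum.cong) (auto split: if_splits)
    then show "(\<Sum>(p, t) | p @ t = w. if t = [] then bcoef v (?s B) * ?Z B p else 0) = bcoef v (?s B) * ?Z B w"
      by simp
  qed
  also have "\<dots> = bernstein v (Poly_Mapping.single I c) * H_word w"
    by (simp add: bernstein_single H_word_eq_single sum_distrib_right mult.assoc mult_single)
  finally show ?thesis .
qed

lemma poly_mapping_eq_sum_single:
  "f = (\<Sum>I\<in>Poly_Mapping.keys f. Poly_Mapping.single I (Poly_Mapping.lookup f I))"
  by (rule poly_mapping_eqI) (simp add: lookup_sum lookup_single when_def in_keys_iff)

lemma bernstein_mult_H_word:
  "bernstein v f * H_word w = (\<Sum>(u, x) | u @ x = w. bernstein (v @ x) (f * H_word u))"
proof -
  let ?m = "\<lambda>I. Poly_Mapping.single I (Poly_Mapping.lookup f I)"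
  have "bernstein v (\<Sum>I\<in>Poly_Mapping.keys f. ?m I) * H_word w =
      (\<Sum>I\<in>Poly_Mapping.keys f. \<Sum>(u, x) | u @ x = w. bernstein (v @ x) (?m I * H_word u))"
    by (simp only: bernstein_sum sum_distrib_right bernstein_single_mult_H_word)
  also have "\<dots> = (\<Sum>(u, x) | u @ x = w. bernstein (v @ x) ((\<Sum>I\<in>Poly_Mapping.keys f. ?m I) * H_word u))"
    unfolding case_prod_unfold bernstein_sum sum_distrib_right by (rule sum.swap)
  finally show ?thesis by (simp only: poly_mapping_eq_sum_single[symmetric])
qed

section \<open>The index set of the Pieri rule and the induction on \<open>J\<close>\<close>

definition pieri_lists :: "'a list list \<Rightarrow> 'a list \<Rightarrow> 'a list list set" where
  "pieri_lists vs w = {ks. [] \<notin> set ks \<and> length vs \<le> length ks \<and> length ks \<le> length vs + 1 \<and>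
     (\<exists>q. length q = length ks \<and>
       (\<forall>j < length ks. ks ! j = (if j < length vs then vs ! j else []) @ q ! j) \<and> concat (rev q) = w)}"

text \<open>With no word to extend, the only possible word is \<open>w\<close> itself, and it is
  absent when \<open>w\<close> is empty because empty words are excluded.\<close>

lemma pieri_lists_Nil: "pieri_lists [] w = (if w = [] then {[]} else {[w]})"
proof (intro set_eqI iffI)
  fix ks assume "ks \<in> pieri_lists [] w"
  then obtain q where q: "[] \<notin> set ks" "length ks \<le> 1" "length q = length ks"
      "\<forall>j < length ks. ks ! j = q ! j" "concat (rev q) = w"
    by (auto simp: pieri_lists_def)
  then have "q = ks" by (simp add: list_eq_iff_nth_eq)
  then show "ks \<in> (if w = [] then {[]} else {[w]})"
    using q by (cases ks) auto
next
  fix ks assume "ks \<in> (if w = [] then {[]} else {[w]})"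
  then show "ks \<in> pieri_lists [] w"
    by (auto simp: pieri_lists_def split: if_splits intro!: exI[of _ ks])
qed

text \<open>The first entry of \<open>q\<close> comes last in \<open>concat (rev q)\<close>, so the
  head takes a suffix \<open>x\<close> of \<open>w\<close> and the tail uses the remaining prefix
  \<open>u\<close>. This is the recursion of \<open>bernstein_mult_H_word\<close>.\<close>

lemma pieri_lists_Cons:
  assumes "v \<noteq> []"
  shows "pieri_lists (v # vs) w = (\<lambda>(y, ks). (v @ snd y) # ks) `
    (SIGMA y:{(u, x). u @ x = w}. pieri_lists vs (fst y))"
proof (intro set_eqI iffI)
  fix ks assume "ks \<in> pieri_lists (v # vs) w"
  then obtain q where q: "[] \<notin> set ks" "length (v # vs) \<le> length ks" "length ks \<le> length (v # vs) + 1"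
      "length q = length ks"
      "\<forall>j < length ks. ks ! j = (if j < length (v # vs) then (v # vs) ! j else []) @ q ! j" "concat (rev q) = w"
    by (auto simp: pieri_lists_def)
  obtain k ks' where ks: "ks = k # ks'" using q(2) by (cases ks) auto
  obtain x q' where q': "q = x # q'" using q(4) ks by (cases q) auto
  have "k = v @ x" "\<forall>j < length ks'. ks' ! j = (if j < length vs then vs ! j else []) @ q' ! j"
    using q(5) by (simp_all add: ks q' All_less_Suc2)
  moreover from this have "ks' \<in> pieri_lists vs (concat (rev q'))"
    using q by (auto simp: pieri_lists_def ks q')
  ultimately show "ks \<in> (\<lambda>(y, ks). (v @ snd y) # ks) ` (SIGMA y:{(u, x). u @ x = w}. pieri_lists vs (fst y))"
    using q(6) by (intro image_eqI[where x = "((concat (rev q'), x), ks')"]) (auto simp: ks q')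
next
  fix ks assume "ks \<in> (\<lambda>(y, ks). (v @ snd y) # ks) ` (SIGMA y:{(u, x). u @ x = w}. pieri_lists vs (fst y))"
  then obtain u x ks' where ks: "ks = (v @ x) # ks'" "u @ x = w" "ks' \<in> pieri_lists vs u" by auto
  then obtain q' where "length q' = length ks'"
      "\<forall>j < length ks'. ks' ! j = (if j < length vs then vs ! j else []) @ q' ! j" "concat (rev q') = u"
    by (auto simp: pieri_lists_def)
  then have "length (x # q') = length ks \<and> concat (rev (x # q')) = w \<and>
      (\<forall>j < length ks. ks ! j = (if j < length (v # vs) then (v # vs) ! j else []) @ (x # q') ! j)"
    using ks by (simp add: All_less_Suc2)
  moreover have "[] \<notin> set ks" "length (v # vs) \<le> length ks" "length ks \<le> length (v # vs) + 1"
    using ks assms by (auto simp: pieri_lists_def)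
  ultimately show "ks \<in> pieri_lists (v # vs) w" unfolding pieri_lists_def by blast
qed

lemma finite_pieri_lists: "[] \<notin> set vs \<Longrightarrow> finite (pieri_lists vs w)"
  by (induction vs arbitrary: w) (auto simp: pieri_lists_Nil pieri_lists_Cons intro!: finite_imageI finite_SigmaI)

lemma refinements_zero: "{Q. Q \<preceq> 0} = {0 :: 'a sentence}"
  by (auto simp: coarsens_def zero_sentence.rep_eq simp flip: words_inject)

text \<open>The empty sentence has one cut and one refinement, both empty, so only the term with
  empty \<open>u\<close> is left.\<close>

lemma bernstein_one: "bernstein w 1 = H_word w"
  using bernstein_single[of w 0 1]
  by (simp add: zero_sentence.rep_eq splits_Nil bcoef_def refinements_zero slen_def)

text \<open>Induction on \<open>vs\<close>: \<open>bernstein_mult_H_word\<close> moves the factor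
  past the outermost operator, and \<open>pieri_lists_Cons\<close> matches the resulting double
  sum.\<close>

lemma foldr_bernstein_mult_H_word:
  "[] \<notin> set vs \<Longrightarrow> foldr bernstein vs 1 * H_word w = (\<Sum>ks\<in>pieri_lists vs w. foldr bernstein ks 1)"
proof (induction vs arbitrary: w)
  case Nil
  then show ?case by (simp add: pieri_lists_Nil bernstein_one) (simp add: H_word_def)
next
  case (Cons v vs)
  let ?P = "SIGMA y:{(u, x). u @ x = w}. pieri_lists vs (fst y)"
  have v: "v \<noteq> []" using Cons.prems by auto
  \<comment> \<open>The head \<open>v @ x\<close> determines \<open>x\<close>, and then
    \<open>u @ x = w\<close> determines \<open>u\<close>.\<close>
  have "inj_on (\<lambda>(y, ks). (v @ snd y) # ks) ?P" by (auto simp: inj_on_def)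
  then have "(\<Sum>ks\<in>pieri_lists (v # vs) w. foldr bernstein ks 1) =
      (\<Sum>(y, ks)\<in>?P. bernstein (v @ snd y) (foldr bernstein ks 1))"
    unfolding pieri_lists_Cons[OF v] by (subst sum.reindex) (auto intro!: sum.cong)
  also have "\<dots> = (\<Sum>y\<in>{(u, x). u @ x = w}. \<Sum>ks\<in>pieri_lists vs (fst y). bernstein (v @ snd y) (foldr bernstein ks 1))"
    by (rule sum.Sigma[symmetric]) (use Cons.prems in \<open>auto intro: finite_pieri_lists\<close>)
  also have "\<dots> = (\<Sum>(u, x) | u @ x = w. bernstein (v @ x) (foldr bernstein vs 1 * H_word u))"
    using Cons by (simp add: case_prod_unfold bernstein_sum)
  also have "\<dots> = foldr bernstein (v # vs) 1 * H_word w"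
    by (simp add: bernstein_mult_H_word)
  finally show ?case by (rule sym)
qed

theorem theorem5p10:
  fixes J :: "'a::finite sentence" and w :: "'a list"
  shows "immaculate J * H_word w =
    (\<Sum>K | slen J \<le> slen K \<and> slen K \<le> slen J + 1 \<and>
        (\<exists>q :: 'a list list. length q = slen K \<and>
           (\<forall>j < slen K. words K ! j = (if j < slen J then words J ! j else []) @ q ! j) \<and>
           concat (rev q) = w).
      immaculate K)"
  (is "_ = sum immaculate ?S")
proof -
  \<comment> \<open>Lists without empty words are exactly the images of sentences under
    \<open>words\<close>, so the list version reindexes to the sum over sentences.\<close>
  have "pieri_lists (words J) w = words ` ?S"
  proof (intro set_eqI iffI)
    fix ks assume ks: "ks \<in> pieri_lists (words J) w"
    then have "words (Sentence ks) = ks" by (simp add: pieri_lists_def Sentence_inverse)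
    with ks show "ks \<in> words ` ?S"
      by (intro image_eqI[where x = "Sentence ks"]) (simp_all add: pieri_lists_def slen_def)
  qed (auto simp: pieri_lists_def slen_def)
  moreover have "inj_on words ?S" by (simp add: inj_on_def words_inject)
  ultimately have "(\<Sum>ks\<in>pieri_lists (words J) w. foldr bernstein ks 1) = sum immaculate ?S"
    by (simp add: sum.reindex immaculate_def)
  then show ?thesis by (simp add: immaculate_def foldr_bernstein_mult_H_word)
qed

end
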